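(* Let $\mathcal{G}=\langle S,s_0,L,\mathrm{Act},\mathrm{step}\rangle$ be a PGS, $\varphi\in\mathcal{L}^{\oplus}$, and $\Delta,\Theta\in\mathrm{Dist}(S)$ with $\Delta\,\overline{\lesssim}\,\Theta$. Then $\Delta\models\varphi$ implies $\Theta\models\varphi$.
   Context: Distributions: $\mathrm{Dist}(S)$ is the set of discrete probability distributions $\Delta:S\to[0,1]$, $\mathrm{Supp}(\Delta)=\{s\mid\Delta(s)>0\}$, $\delta_s$ point distribution. A PGS is $\mathcal{G}=\langle S,s_0,L,\mathrm{Act},\mathrm{step}\rangle$: $S$ finite, $s_0\in S$, $L:S\to2^{\mathrm{Prop}}$ ($\mathrm{Prop}$ finite), $\mathrm{Act}=\mathrm{Act}_{\mathrm{I}}\times\mathrm{Act}_{\mathrm{II}}$ finite, $\mathrm{step}:S\times\mathrm{Act}\to\mathrm{Dist}(S)$. Mixed actions of player $i\in\{\mathrm{I},\mathrm{II}\}$: functions $\pi:S\to\mathrm{Dist}(\mathrm{Act}_i)$, forming $\Pi_i$. $\overline{\mathrm{step}}(s,\langle\pi_1,\pi_2\rangle)(u)=\sum_{a_1,a_2}\pi_1(s)(a_1)\pi_2(s)(a_2)\mathrm{step}(s,\langle a_1,a_2\rangle)(u)$, $\overline{\mathrm{step}}(\Delta,\langle\pi_1,\pi_2\rangle)=\sum_{t\in\mathrm{Supp}(\Delta)}\Delta(t)\overline{\mathrm{step}}(t,\langle\pi_1,\pi_2\rangle)$; $\overline{\mathrm{step}}(s,\pi)=\{\overline{\mathrm{step}}(s,\langle\pi,\pi'\rangle)\mid\pi'\in\Pi_{\mathrm{II}}\}$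 for $\pi\in\Pi_{\mathrm{I}}$. Lifting: for $R\subseteq S\times T$, $\Delta\,\overline{R}\,\Theta$ iff some $w:S\times T\to[0,1]$ has $\sum_tw(s,t)=\Delta(s)$, $\sum_sw(s,t)=\Theta(t)$, and $w(s,t)>0\Rightarrow s\,R\,t$. Smyth order: $P\,R'_{Sm}\,Q$ iff $\forall y\in Q\,\exists x\in P:x\,R'\,y$. A PA-simulation is $\preceq\subseteq S\times S$ with: $s\preceq t$ implies $L(s)=L(t)$ and $\forall\pi_1\in\Pi_{\mathrm{I}}\exists\pi_2\in\Pi_{\mathrm{I}}:\overline{\mathrm{step}}(s,\pi_1)(\overline{\preceq})_{Sm}\overline{\mathrm{step}}(t,\pi_2)$. $\lesssim$ is the largest PA-simulation. Logic $\mathcal{L}^{\oplus}$: $\varphi::=p\mid\neg p\mid\bigwedge_{k\in K}\varphi_k\mid\bigvee_{k\in K}\varphi_k\mid\langle\langle\mathrm{I}\rangle\rangle\varphi\mid\bigoplus_{j\in J}p_j\varphi_j\mid\bigoplus_{j\in J}\varphi_j$ ($p\in\mathrm{Prop}$, arbitrary $K$, nonempty $J$, $p_j\in[0,1]$ summing to $1$). $\Delta\models\varphi$ iff $\Delta\in[\![\varphi]\!]$ where: $[\![p]\!]=\{\Delta\mid\forall s\in\mathrm{Supp}(\Delta):p\in L(s)\}$; $[\![\neg p]\!]=\{\Delta\mid\forall s\in\mathrm{Supp}(\Delta):p\notin L(s)\}$; $\bigwedge,\bigvee$ intersection/union; $[\![\langle\langle\mathrm{I}\rangle\rangle\varphi]\!]=\{\Delta\mid\exists\pi_1\in\Pi_{\mathrm{I}}\forall\pi_2\in\Pi_{\mathrm{II}}:\overline{\mathrm{step}}(\Delta,\langle\pi_1,\pi_2\rangle)\in[\![\varphi]\!]\}$;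 $[\![\bigoplus_jp_j\varphi_j]\!]=\{\sum_jp_j\Delta_j\mid\Delta_j\in[\![\varphi_j]\!]\ \forall j\}$; $[\![\bigoplus_j\varphi_j]\!]=\{\sum_jq_j\Delta_j\mid q_j\ge0,\sum_jq_j=1,\Delta_j\in[\![\varphi_j]\!]\ \forall j\}$. *)

theory Defs
  imports "HOL-Probability.Probability_Mass_Function"
begin

definition Dist :: "'a set \<Rightarrow> 'a pmf set" where
  "Dist A = {\<Delta>. set_pmf \<Delta> \<subseteq> A}"


section \<open>Probabilistic game structures\<close>

record ('s, 'p, 'a, 'b) pgs =
  states :: "'s set"
  init :: 's
  props :: "'p set"
  label :: "'s \<Rightarrow> 'p set"
  actI :: "'a set"
  actII :: "'b set"
  step :: "'s \<Rightarrow> 'a \<times> 'b \<Rightarrow> 's pmf"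

locale probabilistic_game_structure =
  fixes G :: "('s, 'p, 'a, 'b) pgs"
  assumes finite_states: "finite (states G)"
    and init_state: "init G \<in> states G"
    and finite_props: "finite (props G)"
    and label_props: "s \<in> states G \<Longrightarrow> label G s \<subseteq> props G"
    and finite_actI: "finite (actI G)"
    and finite_actII: "finite (actII G)"
    and step_Dist: "\<lbrakk>s \<in> states G; a \<in> actI G \<times> actII G\<rbrakk> \<Longrightarrow> step G s a \<in> Dist (states G)"

definition mixedI :: "('s, 'p, 'a, 'b) pgs \<Rightarrow> ('s \<Rightarrow> 'a pmf) set" where
  "mixedI G = states G \<rightarrow> Dist (actI G)"

definition mixedII :: "('s, 'p, 'a, 'b) pgs \<Rightarrow> ('s \<Rightarrow> 'b pmf) set" where
  "mixedII G = states G \<rightarrow> Dist (actII G)"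

text \<open>The explicit sums that \<^const>\<open>bind_pmf\<close> stands for in the next two definitions are
  given by the lemmas \<open>pmf_step_state\<close> and \<open>pmf_step_dist\<close> below.\<close>

definition step_state ::
  "('s, 'p, 'a, 'b) pgs \<Rightarrow> 's \<Rightarrow> ('s \<Rightarrow> 'a pmf) \<Rightarrow> ('s \<Rightarrow> 'b pmf) \<Rightarrow> 's pmf" where
  "step_state G s \<pi>1 \<pi>2 =
     bind_pmf (\<pi>1 s) (\<lambda>a1. bind_pmf (\<pi>2 s) (\<lambda>a2. step G s (a1, a2)))"

definition step_dist ::
  "('s, 'p, 'a, 'b) pgs \<Rightarrow> 's pmf \<Rightarrow> ('s \<Rightarrow> 'a pmf) \<Rightarrow> ('s \<Rightarrow> 'b pmf) \<Rightarrow> 's pmf" where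
  "step_dist G \<Delta> \<pi>1 \<pi>2 = bind_pmf \<Delta> (\<lambda>t. step_state G t \<pi>1 \<pi>2)"

definition step_set :: "('s, 'p, 'a, 'b) pgs \<Rightarrow> 's \<Rightarrow> ('s \<Rightarrow> 'a pmf) \<Rightarrow> 's pmf set" where
  "step_set G s \<pi> = {step_state G s \<pi> \<pi>' | \<pi>'. \<pi>' \<in> mixedII G}"

lemma pmf_bind_finite:
  assumes "finite A" and "\<Delta> \<in> Dist A"
  shows "pmf (bind_pmf \<Delta> f) u = (\<Sum>a\<in>A. pmf \<Delta> a * pmf (f a) u)"
  using assms by (simp add: pmf_bind integral_measure_pmf[where A = A] Dist_def subset_iff)

lemma (in probabilistic_game_structure) pmf_step_state:
  assumes "\<pi>1 \<in> mixedI G" and "\<pi>2 \<in> mixedII G" and "s \<in> states G"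
  shows "pmf (step_state G s \<pi>1 \<pi>2) u =
    (\<Sum>a1\<in>actI G. \<Sum>a2\<in>actII G. pmf (\<pi>1 s) a1 * pmf (\<pi>2 s) a2 * pmf (step G s (a1, a2)) u)"
proof -
  have "\<pi>1 s \<in> Dist (actI G)" "\<pi>2 s \<in> Dist (actII G)"
    using assms by (auto simp: mixedI_def mixedII_def)
  then show ?thesis
    by (simp add: step_state_def pmf_bind_finite[OF finite_actI] pmf_bind_finite[OF finite_actII]
        sum_distrib_left mult.assoc)
qed

lemma (in probabilistic_game_structure) pmf_step_dist:
  assumes "\<Delta> \<in> Dist (states G)"
  shows "pmf (step_dist G \<Delta> \<pi>1 \<pi>2) u =
    (\<Sum>t\<in>set_pmf \<Delta>. pmf \<Delta> t * pmf (step_state G t \<pi>1 \<pi>2) u)"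
proof -
  have "finite (set_pmf \<Delta>)"
    using assms finite_subset[OF _ finite_states] by (auto simp: Dist_def)
  then show ?thesis
    unfolding step_dist_def by (rule pmf_bind_finite) (simp add: Dist_def)
qed


section \<open>Probabilistic alternating simulation\<close>

text \<open>A joint distribution witnessing \<^const>\<open>rel_pmf\<close> is the weight function of the usual
  lifting of a relation to distributions; see \<open>lift_rel_iff_weight\<close>.\<close>

definition lift_rel :: "('s \<times> 't) set \<Rightarrow> 's pmf \<Rightarrow> 't pmf \<Rightarrow> bool" where
  "lift_rel R = rel_pmf (\<lambda>s t. (s, t) \<in> R)"

definition smyth :: "('a \<Rightarrow> 'b \<Rightarrow> bool) \<Rightarrow> 'a set \<Rightarrow> 'b set \<Rightarrow> bool" where
  "smyth R P Q \<longleftrightarrow> (\<forall>y\<in>Q. \<exists>x\<in>P. R x y)"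

definition pa_simulation :: "('s, 'p, 'a, 'b) pgs \<Rightarrow> ('s \<times> 's) set \<Rightarrow> bool" where
  "pa_simulation G R \<longleftrightarrow>
     R \<subseteq> states G \<times> states G \<and>
     (\<forall>(s, t)\<in>R. label G s = label G t \<and>
        (\<forall>\<pi>1\<in>mixedI G. \<exists>\<pi>2\<in>mixedI G.
           smyth (lift_rel R) (step_set G s \<pi>1) (step_set G t \<pi>2)))"

definition pa_sim :: "('s, 'p, 'a, 'b) pgs \<Rightarrow> ('s \<times> 's) set" where
  "pa_sim G = \<Union> {R. pa_simulation G R}"

lemma lift_rel_iff_weight:
  fixes \<Delta> :: "'s pmf" and \<Theta> :: "'t pmf"
  assumes fin: "finite S" "finite T" and \<Delta>: "\<Delta> \<in> Dist S" and \<Theta>: "\<Theta> \<in> Dist T"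
  shows "lift_rel R \<Delta> \<Theta> \<longleftrightarrow>
    (\<exists>w :: 's \<times> 't \<Rightarrow> real. w \<in> S \<times> T \<rightarrow> {0..1} \<and>
      (\<forall>s\<in>S. (\<Sum>t\<in>T. w (s, t)) = pmf \<Delta> s) \<and>
      (\<forall>t\<in>T. (\<Sum>s\<in>S. w (s, t)) = pmf \<Theta> t) \<and>
      (\<forall>s\<in>S. \<forall>t\<in>T. w (s, t) > 0 \<longrightarrow> (s, t) \<in> R))" (is "_ = (\<exists>w. ?W w)")
proof
  assume "lift_rel R \<Delta> \<Theta>"
  then obtain pq where pq: "\<And>x y. (x, y) \<in> set_pmf pq \<Longrightarrow> (x, y) \<in> R"
    and fst: "map_pmf fst pq = \<Delta>" and snd: "map_pmf snd pq = \<Theta>"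
    unfolding lift_rel_def by (auto elim: rel_pmf.cases)
  have sub: "set_pmf pq \<subseteq> S \<times> T"
    using \<Delta> \<Theta> unfolding Dist_def fst[symmetric] snd[symmetric] by force
  have "(\<Sum>t\<in>T. pmf pq (s, t)) = pmf \<Delta> s" if "s \<in> S" for s
  proof -
    have "pmf \<Delta> s = measure pq (fst -` {s})"
      by (simp add: fst[symmetric] pmf_map)
    also have "\<dots> = measure pq ({s} \<times> T)"
      by (rule measure_pmf.finite_measure_eq_AE) (use sub in \<open>auto simp: AE_measure_pmf_iff\<close>)
    also have "\<dots> = (\<Sum>x\<in>{s} \<times> T. pmf pq x)"
      using fin by (simp add: measure_measure_pmf_finite)
    also have "\<dots> = (\<Sum>t\<in>T. pmf pq (s, t))"
      by (simp add: sum.cartesian_product[symmetric, of "\<lambda>x y. pmf pq (x, y)", simplified])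
    finally show ?thesis by simp
  qed
  moreover have "(\<Sum>s\<in>S. pmf pq (s, t)) = pmf \<Theta> t" if "t \<in> T" for t
  proof -
    have "pmf \<Theta> t = measure pq (snd -` {t})"
      by (simp add: snd[symmetric] pmf_map)
    also have "\<dots> = measure pq (S \<times> {t})"
      by (rule measure_pmf.finite_measure_eq_AE) (use sub in \<open>auto simp: AE_measure_pmf_iff\<close>)
    also have "\<dots> = (\<Sum>x\<in>S \<times> {t}. pmf pq x)"
      using fin by (simp add: measure_measure_pmf_finite)
    also have "\<dots> = (\<Sum>s\<in>S. pmf pq (s, t))"
      by (simp add: sum.cartesian_product[symmetric, of "\<lambda>x y. pmf pq (x, y)", simplified])
    finally show ?thesis by simp
  qed
  ultimately have "?W (pmf pq)"
    using pq by (auto simp: pmf_le_1 set_pmf_iff)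
  then show "\<exists>w. ?W w" by (intro exI)
next
  assume "\<exists>w. ?W w"
  then obtain w where w: "?W w" ..
  define f where "f x = (if x \<in> S \<times> T then w x else 0)" for x
  have f_nonneg: "f x \<ge> 0" for x
    using w by (auto simp: f_def Pi_iff)
  have "(\<Sum>x\<in>S \<times> T. f x) = (\<Sum>s\<in>S. \<Sum>t\<in>T. w (s, t))"
    by (simp add: sum.cartesian_product f_def)
  also have "\<dots> = (\<Sum>s\<in>S. pmf \<Delta> s)"
    using w by simp
  also have "\<dots> = 1"
    using \<Delta> fin by (intro sum_pmf_eq_1) (auto simp: Dist_def)
  finally have f_sum: "(\<Sum>x\<in>S \<times> T. f x) = 1" .
  have "(\<integral>\<^sup>+x. ennreal (f x) \<partial>count_space UNIV) = (\<Sum>x\<in>S \<times> T. ennreal (f x))"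
    using fin by (intro nn_integral_count_space') (auto simp: f_def)
  also have "\<dots> = 1"
    using f_sum f_nonneg by (simp add: sum_ennreal)
  finally have pmf_f: "pmf (embed_pmf f) x = f x" for x
    using f_nonneg by (simp add: pmf_embed_pmf)
  define pq where "pq = embed_pmf f"
  have pq: "pmf pq x = f x" for x
    by (simp add: pq_def pmf_f)
  have sub: "set_pmf pq \<subseteq> S \<times> T"
    by (auto simp: set_pmf_iff pq f_def split: if_splits)
  have fst: "map_pmf fst pq = \<Delta>"
  proof (rule pmf_eqI)
    fix s
    have "pmf (map_pmf fst pq) s = measure pq (fst -` {s})"
      by (simp add: pmf_map)
    also have "\<dots> = measure pq ({s} \<times> T)"
      by (rule measure_pmf.finite_measure_eq_AE) (use sub in \<open>auto simp: AE_measure_pmf_iff\<close>)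
    also have "\<dots> = (\<Sum>x\<in>{s} \<times> T. pmf pq x)"
      using fin by (simp add: measure_measure_pmf_finite)
    also have "\<dots> = (\<Sum>t\<in>T. f (s, t))"
      by (simp add: pq sum.cartesian_product[symmetric, of "\<lambda>x y. f (x, y)", simplified])
    also have "\<dots> = pmf \<Delta> s"
      using w \<Delta> by (cases "s \<in> S") (auto simp: f_def Dist_def set_pmf_iff)
    finally show "pmf (map_pmf fst pq) s = pmf \<Delta> s" .
  qed
  have snd: "map_pmf snd pq = \<Theta>"
  proof (rule pmf_eqI)
    fix t
    have "pmf (map_pmf snd pq) t = measure pq (snd -` {t})"
      by (simp add: pmf_map)
    also have "\<dots> = measure pq (S \<times> {t})"
      by (rule measure_pmf.finite_measure_eq_AE) (use sub in \<open>auto simp: AE_measure_pmf_iff\<close>)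
    also have "\<dots> = (\<Sum>x\<in>S \<times> {t}. pmf pq x)"
      using fin by (simp add: measure_measure_pmf_finite)
    also have "\<dots> = (\<Sum>s\<in>S. f (s, t))"
      by (simp add: pq sum.cartesian_product[symmetric, of "\<lambda>x y. f (x, y)", simplified])
    also have "\<dots> = pmf \<Theta> t"
      using w \<Theta> by (cases "t \<in> T") (auto simp: f_def Dist_def set_pmf_iff)
    finally show "pmf (map_pmf snd pq) t = pmf \<Theta> t" .
  qed
  have "(x, y) \<in> R" if "(x, y) \<in> set_pmf pq" for x y
  proof -
    have "f (x, y) > 0" "(x, y) \<in> S \<times> T"
      using that sub f_nonneg[of "(x, y)"] by (auto simp: set_pmf_iff pq less_le)
    then show ?thesis using w by (auto simp: f_def)
  qed
  then show "lift_rel R \<Delta> \<Theta>"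
    unfolding lift_rel_def using fst snd by (auto intro!: rel_pmf.intros)
qed

lemma lift_rel_mono: "R \<subseteq> R' \<Longrightarrow> lift_rel R \<Delta> \<Theta> \<Longrightarrow> lift_rel R' \<Delta> \<Theta>"
  unfolding lift_rel_def by (erule pmf.rel_mono_strong) auto

lemma pa_simulation_pa_sim: "pa_simulation G (pa_sim G)"
  unfolding pa_simulation_def
proof (intro conjI ballI, safe)
  fix s t assume "(s, t) \<in> pa_sim G"
  then show "s \<in> states G" "t \<in> states G"
    by (auto simp: pa_sim_def pa_simulation_def)
next
  fix s t p assume st: "(s, t) \<in> pa_sim G"
  then show "p \<in> label G s \<Longrightarrow> p \<in> label G t" "p \<in> label G t \<Longrightarrow> p \<in> label G s"
    by (auto simp: pa_sim_def pa_simulation_def)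
next
  fix s t \<pi>1 assume "(s, t) \<in> pa_sim G" and \<pi>1: "\<pi>1 \<in> mixedI G"
  then obtain R where R: "pa_simulation G R" and "(s, t) \<in> R"
    by (auto simp: pa_sim_def)
  with \<pi>1 obtain \<pi>2 where "\<pi>2 \<in> mixedI G"
    and "smyth (lift_rel R) (step_set G s \<pi>1) (step_set G t \<pi>2)"
    unfolding pa_simulation_def by blast
  moreover have "R \<subseteq> pa_sim G"
    using R by (auto simp: pa_sim_def)
  ultimately show "\<exists>\<pi>2\<in>mixedI G. smyth (lift_rel (pa_sim G)) (step_set G s \<pi>1) (step_set G t \<pi>2)"
    unfolding smyth_def using lift_rel_mono by meson
qed

lemma pa_sim_greatest: "pa_simulation G R \<Longrightarrow> R \<subseteq> pa_sim G"
  by (auto simp: pa_sim_def)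


section \<open>The logic\<close>

text \<open>Index sets \<open>K\<close>, \<open>J\<close> are arbitrary sets over an arbitrary type \<open>'k\<close>; only the values of the
  family on the index set matter.  The weights of \<open>WSum\<close>, nonnegative reals indexed by \<open>J\<close> with
  sum 1, are a probability mass function supported in \<open>J\<close>; weight 0 is allowed on members of
  \<open>J\<close>.\<close>

datatype ('p, 'k) fmla =
    Atom 'p
  | NegAtom 'p
  | Conj "'k set" "'k \<Rightarrow> ('p, 'k) fmla"
  | Disj "'k set" "'k \<Rightarrow> ('p, 'k) fmla"
  | Enforce "('p, 'k) fmla"
  | WSum "'k set" "'k pmf" "'k \<Rightarrow> ('p, 'k) fmla"
  | USum "'k set" "'k \<Rightarrow> ('p, 'k) fmla"

primrec wf_fmla :: "'p set \<Rightarrow> ('p, 'k) fmla \<Rightarrow> bool" where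
  "wf_fmla P (Atom p) \<longleftrightarrow> p \<in> P"
| "wf_fmla P (NegAtom p) \<longleftrightarrow> p \<in> P"
| "wf_fmla P (Conj K \<phi>) \<longleftrightarrow> (\<forall>k\<in>K. wf_fmla P (\<phi> k))"
| "wf_fmla P (Disj K \<phi>) \<longleftrightarrow> (\<forall>k\<in>K. wf_fmla P (\<phi> k))"
| "wf_fmla P (Enforce \<phi>) \<longleftrightarrow> wf_fmla P \<phi>"
| "wf_fmla P (WSum J p \<phi>) \<longleftrightarrow> J \<noteq> {} \<and> p \<in> Dist J \<and> (\<forall>j\<in>J. wf_fmla P (\<phi> j))"
| "wf_fmla P (USum J \<phi>) \<longleftrightarrow> J \<noteq> {} \<and> (\<forall>j\<in>J. wf_fmla P (\<phi> j))"

text \<open>For \<open>q \<in> Dist J\<close>, the convex combination of a family \<open>D\<close> of distributions with weights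
  \<open>q\<close> is \<open>bind_pmf q D\<close>; see \<open>pmf_bind_infsum\<close>.\<close>

primrec sem :: "('s, 'p, 'a, 'b) pgs \<Rightarrow> ('p, 'k) fmla \<Rightarrow> 's pmf set" where
  "sem G (Atom p) = {\<Delta> \<in> Dist (states G). \<forall>s\<in>set_pmf \<Delta>. p \<in> label G s}"
| "sem G (NegAtom p) = {\<Delta> \<in> Dist (states G). \<forall>s\<in>set_pmf \<Delta>. p \<notin> label G s}"
| "sem G (Conj K \<phi>) = {\<Delta> \<in> Dist (states G). \<forall>k\<in>K. \<Delta> \<in> sem G (\<phi> k)}"
| "sem G (Disj K \<phi>) = {\<Delta> \<in> Dist (states G). \<exists>k\<in>K. \<Delta> \<in> sem G (\<phi> k)}"
| "sem G (Enforce \<phi>) = {\<Delta> \<in> Dist (states G).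
     \<exists>\<pi>1\<in>mixedI G. \<forall>\<pi>2\<in>mixedII G. step_dist G \<Delta> \<pi>1 \<pi>2 \<in> sem G \<phi>}"
| "sem G (WSum J p \<phi>) = {bind_pmf p D | D. \<forall>j\<in>J. D j \<in> sem G (\<phi> j)}"
| "sem G (USum J \<phi>) = {bind_pmf q D | q D. q \<in> Dist J \<and> (\<forall>j\<in>J. D j \<in> sem G (\<phi> j))}"

lemma pmf_bind_infsum:
  assumes "q \<in> Dist J"
  shows "pmf (bind_pmf q D) u = (\<Sum>\<^sub>\<infinity>j\<in>J. pmf q j * pmf (D j) u)"
proof -
  have dens: "measure_pmf q = density (count_space UNIV) (\<lambda>j. ennreal (pmf q j))"
    by (rule measure_pmf_eq_density)
  have "integrable (measure_pmf q) (\<lambda>j. pmf (D j) u)"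
    by (rule measure_pmf.integrable_const_bound[where B = 1]) (auto simp: pmf_le_1)
  then have int: "integrable (count_space UNIV) (\<lambda>j. pmf q j * pmf (D j) u)"
    unfolding dens by (subst (asm) integrable_density) auto
  have "pmf (bind_pmf q D) u = (\<integral>j. pmf q j * pmf (D j) u \<partial>count_space UNIV)"
    unfolding pmf_bind dens by (subst integral_density) auto
  also have "\<dots> = (\<Sum>\<^sub>\<infinity>j. pmf q j * pmf (D j) u)"
    using int by (subst infsetsum_infsum[symmetric]) (auto simp: infsetsum_def abs_summable_on_def)
  also have "\<dots> = (\<Sum>\<^sub>\<infinity>j\<in>J. pmf q j * pmf (D j) u)"
    using assms by (intro infsum_cong_neutral) (auto simp: Dist_def set_pmf_iff)
  finally show ?thesis .
qed

lemma sem_subset_Dist: "wf_fmla P \<phi> \<Longrightarrow> sem G \<phi> \<subseteq> Dist (states G)"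
proof (induction \<phi>)
  case (WSum J p \<phi>)
  then have "\<And>j. j \<in> J \<Longrightarrow> sem G (\<phi> j) \<subseteq> Dist (states G)" and "set_pmf p \<subseteq> J"
    by (auto simp: Dist_def)
  then show ?case by (force simp: Dist_def)
next
  case (USum J \<phi>)
  then have "\<And>j. j \<in> J \<Longrightarrow> sem G (\<phi> j) \<subseteq> Dist (states G)"
    by auto
  then show ?case by (force simp: Dist_def)
qed auto

definition satisfies ::
  "('s, 'p, 'a, 'b) pgs \<Rightarrow> 's pmf \<Rightarrow> ('p, 'k) fmla \<Rightarrow> bool" where
  "satisfies G \<Delta> \<phi> \<longleftrightarrow> \<Delta> \<in> sem G \<phi>"

end

theory Submission imports Defs begin

text \<open>By induction, the semantics of every formula is closed under the lifted simulation.
  Disintegrate a coupling of \<open>\<Delta>\<close> and \<open>\<Theta>\<close> along either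
  marginal.  For \<open>\<langle>\<langle>I\<rangle>\<rangle>\<close>, the new strategy plays at \<open>t\<close> the average, over the
  conditional distribution of \<open>s\<close> given \<open>t\<close>, of the actions by which \<open>t\<close> simulates
  \<open>s\<close>; a response to it is pulled back to \<open>s\<close> by averaging over \<open>t\<close> given
  \<open>s\<close>.  Since steps are bilinear in the two mixed actions, both sides become averages over
  the coupling.  For convex combinations, each component of \<open>\<Delta>\<close> is pushed through
  the conditional distributions of \<open>t\<close> given \<open>s\<close>.\<close>

section \<open>Conditioning on fibres and kernels of couplings\<close>

lemma bind_cond_pmf_fibres: "bind_pmf (map_pmf f p) (\<lambda>y. cond_pmf p (f -` {y})) = p"
  unfolding vimage_def
  \<comment> \<open>The relation is written with \<open>\<in> {y}\<close> so that its sections are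
    literally the unfolded preimages of \<open>{y}\<close>.\<close>
  by (rule bind_cond_pmf_cancel[where R = "\<lambda>y x. f x \<in> {y}"])
    (auto simp: vimage_def intro: arg_cong[where f = "measure_pmf.prob p"])

lemma set_cond_pmf_fibre:
  "y \<in> f ` set_pmf p \<Longrightarrow> set_pmf (cond_pmf p (f -` {y})) = {x \<in> set_pmf p. f x = y}"
  by (subst set_cond_pmf) auto

text \<open>\<open>K x\<close> is the law of the second component of a coupling, given that the
  first is \<open>x\<close>.\<close>

lemma rel_pmf_kernel:
  assumes "rel_pmf R p q"
  obtains K where "q = bind_pmf p K" and "\<And>x y. x \<in> set_pmf p \<Longrightarrow> y \<in> set_pmf (K x) \<Longrightarrow> R x y"
proof -
  obtain pq where pq: "\<And>x y. (x, y) \<in> set_pmf pq \<Longrightarrow> R x y"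
    and p: "map_pmf fst pq = p" and q: "map_pmf snd pq = q"
    using assms by (auto elim: rel_pmf.cases)
  define K where "K x = map_pmf snd (cond_pmf pq (fst -` {x}))" for x
  have "q = bind_pmf p K"
    unfolding K_def map_bind_pmf[symmetric] p[symmetric] bind_cond_pmf_fibres q ..
  moreover have "R x y" if "x \<in> set_pmf p" "y \<in> set_pmf (K x)" for x y
    using that by (auto simp: K_def p[symmetric] set_cond_pmf_fibre intro: pq)
  ultimately show thesis by (rule that)
qed

lemma rel_pmf_bind_kernel:
  assumes "\<And>x y. x \<in> set_pmf p \<Longrightarrow> y \<in> set_pmf (K x) \<Longrightarrow> R x y"
  shows "rel_pmf R p (bind_pmf p K)"
proof -
  \<comment> \<open>With \<open>p\<close> itself written as a mixture, the identity coupling of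
    \<open>p\<close> reduces the claim to a point mass at \<open>x\<close> against
    \<open>K x\<close>.\<close>
  have "rel_pmf R (bind_pmf p return_pmf) (bind_pmf p K)"
    by (rule rel_pmf_bindI[where R = "\<lambda>x y. x = y \<and> x \<in> set_pmf p"])
      (auto intro!: rel_pmf_reflI simp: assms rel_pmf_return_pmf1)
  then show ?thesis by (simp add: bind_return_pmf')
qed

section \<open>Lifting through steps and mixtures\<close>

lemma step_state_bind1:
  assumes "\<pi> s = bind_pmf c (\<lambda>x. f x s)"
  shows "step_state G s \<pi> \<sigma> = bind_pmf c (\<lambda>x. step_state G s (f x) \<sigma>)"
  by (simp add: step_state_def assms bind_assoc_pmf)

text \<open>The draw from \<open>c\<close> comes after player I's action but is independent of it,
  so it commutes to the front.\<close>

lemma step_state_bind2: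
  assumes "\<sigma> s = bind_pmf c (\<lambda>x. f x s)"
  shows "step_state G s \<pi> \<sigma> = bind_pmf c (\<lambda>x. step_state G s \<pi> (f x))"
  by (simp add: step_state_def assms bind_assoc_pmf bind_commute_pmf[of c])

text \<open>Tower property. The identity is asked only at values taken on the support, because the
  averaged strategies below are mixtures only there.\<close>

lemma bind_map_pmf_disintegrate:
  assumes "\<And>x. x \<in> set_pmf p \<Longrightarrow> h (f x) = bind_pmf (cond_pmf p (f -` {f x})) g"
  shows "bind_pmf (map_pmf f p) h = bind_pmf p g"
proof -
  have "bind_pmf (map_pmf f p) h = bind_pmf (map_pmf f p) (\<lambda>y. bind_pmf (cond_pmf p (f -` {y})) g)"
    using assms by (intro bind_pmf_cong) auto
  also have "\<dots> = bind_pmf p g"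
    by (simp only: bind_assoc_pmf[symmetric] bind_cond_pmf_fibres)
  finally show ?thesis .
qed

text \<open>The quantifier order matters: \<open>\<rho>\<close> is fixed before
  \<open>\<sigma>\<close> is known, so it uses only the coupling and the simulating strategies,
  whereas \<open>\<sigma>'\<close> may depend on \<open>\<sigma>\<close>.\<close>

lemma lift_rel_enforce:
  assumes sim: "pa_simulation G R" and lift: "lift_rel R \<Delta> \<Theta>"
    and \<pi>: "\<pi> \<in> mixedI G"
  obtains \<rho> where "\<rho> \<in> mixedI G"
    and "\<And>\<sigma>. \<sigma> \<in> mixedII G \<Longrightarrow>
      \<exists>\<sigma>'\<in>mixedII G. lift_rel R (step_dist G \<Delta> \<pi> \<sigma>') (step_dist G \<Theta> \<rho> \<sigma>)"
proof -
  obtain w where w: "\<And>s t. (s, t) \<in> set_pmf w \<Longrightarrow> (s, t) \<in> R"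
    and \<Delta>_w: "map_pmf fst w = \<Delta>" and \<Theta>_w: "map_pmf snd w = \<Theta>"
    using lift unfolding lift_rel_def by (auto elim: rel_pmf.cases)
  have "\<forall>x\<in>R. \<exists>\<rho>\<in>mixedI G. smyth (lift_rel R) (step_set G (fst x) \<pi>) (step_set G (snd x) \<rho>)"
    using sim \<pi> unfolding pa_simulation_def by fastforce
  \<comment> \<open>The simulating strategy depends on the whole pair, not only on its second state;
    hence the averaging in \<open>\<rho>\<close>.\<close>
  then obtain r where r: "\<And>x. x \<in> R \<Longrightarrow> r x \<in> mixedI G"
    and r_smyth: "\<And>x. x \<in> R \<Longrightarrow>
      smyth (lift_rel R) (step_set G (fst x) \<pi>) (step_set G (snd x) (r x))"
    by metis
  have R_states: "fst x \<in> states G" "snd x \<in> states G" if "x \<in> R" for x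
    using sim that by (auto simp: pa_simulation_def)
  \<comment> \<open>Off the support of \<open>\<Theta>\<close> there is no event to condition on;
    the default \<open>\<pi> t\<close> keeps \<open>\<rho>\<close> in
    \<open>mixedI G\<close>.\<close>
  define \<rho> where "\<rho> t = (if t \<in> set_pmf \<Theta>
    then bind_pmf (cond_pmf w (snd -` {t})) (\<lambda>x. r x t) else \<pi> t)" for t
  show thesis
  proof
    have "set_pmf (\<rho> t) \<subseteq> actI G" if "t \<in> states G" for t
    proof (cases "t \<in> set_pmf \<Theta>")
      case True
      then have "set_pmf (cond_pmf w (snd -` {t})) \<subseteq> R"
        using w by (auto simp: \<Theta>_w[symmetric] set_cond_pmf_fibre)
      then show ?thesis
        using True r that by (fastforce simp: \<rho>_def mixedI_def Dist_def)
    next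
      case False
      then show ?thesis
        using \<pi> that by (auto simp: \<rho>_def mixedI_def Dist_def)
    qed
    then show "\<rho> \<in> mixedI G"
      by (auto simp: mixedI_def Dist_def)
  next
    fix \<sigma> assume \<sigma>: "\<sigma> \<in> mixedII G"
    have "\<forall>x\<in>R. \<exists>\<sigma>'\<in>mixedII G.
        lift_rel R (step_state G (fst x) \<pi> \<sigma>') (step_state G (snd x) (r x) \<sigma>)"
      using r_smyth \<sigma> unfolding smyth_def step_set_def by blast
    then obtain q where q: "\<And>x. x \<in> R \<Longrightarrow> q x \<in> mixedII G"
      and q_lift: "\<And>x. x \<in> R \<Longrightarrow>
        lift_rel R (step_state G (fst x) \<pi> (q x)) (step_state G (snd x) (r x) \<sigma>)"
      by metis
    \<comment> \<open>The marginals swap roles: at \<open>s\<close>, mix the responses found for the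
      pairs with first component \<open>s\<close>.\<close>
    define \<sigma>' where "\<sigma>' s = (if s \<in> set_pmf \<Delta>
      then bind_pmf (cond_pmf w (fst -` {s})) (\<lambda>x. q x s) else \<sigma> s)" for s
    have "set_pmf (\<sigma>' s) \<subseteq> actII G" if "s \<in> states G" for s
    proof (cases "s \<in> set_pmf \<Delta>")
      case True
      then have "set_pmf (cond_pmf w (fst -` {s})) \<subseteq> R"
        using w by (auto simp: \<Delta>_w[symmetric] set_cond_pmf_fibre)
      then show ?thesis
        using True q that by (fastforce simp: \<sigma>'_def mixedII_def Dist_def)
    next
      case False
      then show ?thesis
        using \<sigma> that by (auto simp: \<sigma>'_def mixedII_def Dist_def)
    qed
    then have "\<sigma>' \<in> mixedII G"
      by (auto simp: mixedII_def Dist_def)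
    moreover have "step_dist G \<Delta> \<pi> \<sigma>' = bind_pmf w (\<lambda>x. step_state G (fst x) \<pi> (q x))"
      unfolding step_dist_def \<Delta>_w[symmetric]
    proof (rule bind_map_pmf_disintegrate)
      fix x assume x: "x \<in> set_pmf w"
      then have "fst x \<in> set_pmf \<Delta>"
        by (auto simp: \<Delta>_w[symmetric])
      then have "step_state G (fst x) \<pi> \<sigma>' =
          bind_pmf (cond_pmf w (fst -` {fst x})) (\<lambda>y. step_state G (fst x) \<pi> (q y))"
        by (intro step_state_bind2) (simp add: \<sigma>'_def)
      \<comment> \<open>All \<open>y\<close> in the conditional support share the first component of
        \<open>x\<close>; the integrand now depends on \<open>y\<close> alone, as the tower property
        requires.\<close>
      also have "\<dots> = bind_pmf (cond_pmf w (fst -` {fst x})) (\<lambda>y. step_state G (fst y) \<pi> (q y))"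
        using x by (intro bind_pmf_cong) (auto simp: set_cond_pmf_fibre)
      finally show "step_state G (fst x) \<pi> \<sigma>' = \<dots>" .
    qed
    moreover have "step_dist G \<Theta> \<rho> \<sigma> = bind_pmf w (\<lambda>x. step_state G (snd x) (r x) \<sigma>)"
      unfolding step_dist_def \<Theta>_w[symmetric]
    proof (rule bind_map_pmf_disintegrate)
      fix x assume x: "x \<in> set_pmf w"
      then have "snd x \<in> set_pmf \<Theta>"
        by (auto simp: \<Theta>_w[symmetric])
      then have "step_state G (snd x) \<rho> \<sigma> =
          bind_pmf (cond_pmf w (snd -` {snd x})) (\<lambda>y. step_state G (snd x) (r y) \<sigma>)"
        by (intro step_state_bind1) (simp add: \<rho>_def)
      also have "\<dots> = bind_pmf (cond_pmf w (snd -` {snd x})) (\<lambda>y. step_state G (snd y) (r y) \<sigma>)"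
        using x by (intro bind_pmf_cong) (auto simp: set_cond_pmf_fibre)
      finally show "step_state G (snd x) \<rho> \<sigma> = \<dots>" .
    qed
    \<comment> \<open>Draw the same pair on both sides and relate the steps pair by pair.\<close>
    moreover have "lift_rel R (bind_pmf w (\<lambda>x. step_state G (fst x) \<pi> (q x)))
        (bind_pmf w (\<lambda>x. step_state G (snd x) (r x) \<sigma>))"
      unfolding lift_rel_def
      by (rule rel_pmf_bindI[where R = "\<lambda>x y. x = y \<and> x \<in> R"])
        (use w q_lift in \<open>auto intro!: rel_pmf_reflI simp: lift_rel_def\<close>)
    ultimately show "\<exists>\<sigma>'\<in>mixedII G. lift_rel R (step_dist G \<Delta> \<pi> \<sigma>') (step_dist G \<Theta> \<rho> \<sigma>)"
      by metis
  qed
qed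

text \<open>One kernel serves every component of positive weight, whose support lies in that of the
  mixture. Components of weight 0 stay unchanged: they do not affect the mixture, but the semantics
  of sums constrains them too.\<close>

lemma lift_rel_bind_split:
  assumes "lift_rel R (bind_pmf p D) \<Theta>"
  obtains D' where "\<Theta> = bind_pmf p D'"
    and "\<And>j. j \<in> set_pmf p \<Longrightarrow> lift_rel R (D j) (D' j)"
    and "\<And>j. j \<notin> set_pmf p \<Longrightarrow> D' j = D j"
proof -
  obtain K where \<Theta>: "\<Theta> = bind_pmf (bind_pmf p D) K"
    and K: "\<And>s t. s \<in> set_pmf (bind_pmf p D) \<Longrightarrow> t \<in> set_pmf (K s) \<Longrightarrow> (s, t) \<in> R"
    using assms unfolding lift_rel_def by (rule rel_pmf_kernel) blast
  define D' where "D' j = (if j \<in> set_pmf p then bind_pmf (D j) K else D j)" for j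
  show thesis
  proof
    show "\<Theta> = bind_pmf p D'"
      unfolding \<Theta> bind_assoc_pmf by (intro bind_pmf_cong) (auto simp: D'_def)
    show "lift_rel R (D j) (D' j)" if "j \<in> set_pmf p" for j
    proof -
      have "lift_rel R (D j) (bind_pmf (D j) K)"
        unfolding lift_rel_def by (rule rel_pmf_bind_kernel, rule K) (use that in auto)
      then show ?thesis
        using that by (simp add: D'_def)
    qed
  qed (simp add: D'_def)
qed

section \<open>Preservation by induction on formulas\<close>

lemma lift_rel_set2:
  assumes "lift_rel R \<Delta> \<Theta>" and "t \<in> set_pmf \<Theta>"
  obtains s where "s \<in> set_pmf \<Delta>" and "(s, t) \<in> R"
  using assms rel_setD2[OF rel_pmf_imp_rel_set[of _ \<Delta> \<Theta>]] unfolding lift_rel_def by fast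

lemma Dist_lift_rel:
  assumes "pa_simulation G R" and "lift_rel R \<Delta> \<Theta>"
  shows "\<Theta> \<in> Dist (states G)"
proof -
  have "t \<in> states G" if "t \<in> set_pmf \<Theta>" for t
    using assms(2) that by (rule lift_rel_set2) (use assms(1) in \<open>unfold pa_simulation_def, blast\<close>)
  then show ?thesis by (auto simp: Dist_def)
qed

lemma pa_simulation_label: "pa_simulation G R \<Longrightarrow> (s, t) \<in> R \<Longrightarrow> label G s = label G t"
  unfolding pa_simulation_def by blast

lemma sem_lift_rel:
  assumes sim: "pa_simulation G R"
  shows "wf_fmla P \<phi> \<Longrightarrow> lift_rel R \<Delta> \<Theta> \<Longrightarrow> \<Delta> \<in> sem G \<phi> \<Longrightarrow> \<Theta> \<in> sem G \<phi>"
\<comment> \<open>Both distributions vary, since the hypothesis is applied to successors and to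
  components of mixtures.\<close>
proof (induction \<phi> arbitrary: \<Delta> \<Theta>)
  case (Atom p)
  have "p \<in> label G t" if "t \<in> set_pmf \<Theta>" for t
    using Atom.prems(2) that
    by (rule lift_rel_set2) (use Atom.prems(3) pa_simulation_label[OF sim] in auto)
  then show ?case
    using Dist_lift_rel[OF sim Atom.prems(2)] by simp
next
  case (NegAtom p)
  \<comment> \<open>Related states have equal labels, so absence of \<open>p\<close> transfers as
    well as presence.\<close>
  have "p \<notin> label G t" if "t \<in> set_pmf \<Theta>" for t
    using NegAtom.prems(2) that
    by (rule lift_rel_set2) (use NegAtom.prems(3) pa_simulation_label[OF sim] in auto)
  then show ?case
    using Dist_lift_rel[OF sim NegAtom.prems(2)] by simp
next
  case (Conj K \<phi>)
  have "\<Theta> \<in> sem G (\<phi> k)" if "k \<in> K" for k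
    by (rule Conj.IH[OF rangeI _ Conj.prems(2)]) (use Conj.prems that in auto)
  then show ?case
    using Dist_lift_rel[OF sim Conj.prems(2)] by simp
next
  case (Disj K \<phi>)
  then obtain k where "k \<in> K" and "\<Delta> \<in> sem G (\<phi> k)" and "wf_fmla P (\<phi> k)"
    by auto
  then have "\<Theta> \<in> sem G (\<phi> k)"
    using Disj.IH[of "\<phi> k", OF rangeI _ Disj.prems(2)] by blast
  then show ?case
    using \<open>k \<in> K\<close> Dist_lift_rel[OF sim Disj.prems(2)] by auto
next
  case (Enforce \<phi>)
  from Enforce.prems(3) obtain \<pi> where "\<pi> \<in> mixedI G"
    and \<pi>: "\<And>\<sigma>. \<sigma> \<in> mixedII G \<Longrightarrow> step_dist G \<Delta> \<pi> \<sigma> \<in> sem G \<phi>"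
    by auto
  have \<Theta>: "\<Theta> \<in> Dist (states G)"
    using sim Enforce.prems(2) by (rule Dist_lift_rel)
  obtain \<rho> where \<rho>: "\<rho> \<in> mixedI G"
    and step: "\<And>\<sigma>. \<sigma> \<in> mixedII G \<Longrightarrow>
      \<exists>\<sigma>'\<in>mixedII G. lift_rel R (step_dist G \<Delta> \<pi> \<sigma>') (step_dist G \<Theta> \<rho> \<sigma>)"
    using lift_rel_enforce[OF sim Enforce.prems(2) \<open>\<pi> \<in> mixedI G\<close>] by blast
  have "step_dist G \<Theta> \<rho> \<sigma> \<in> sem G \<phi>" if \<sigma>: "\<sigma> \<in> mixedII G" for \<sigma>
  proof -
    \<comment> \<open>The response to \<open>\<rho>\<close> is pulled back to one against
      \<open>\<pi>\<close>, where \<open>\<phi>\<close> is enforced; the hypothesis carries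
      \<open>\<phi>\<close> forward again.\<close>
    obtain \<sigma>' where "\<sigma>' \<in> mixedII G"
      and "lift_rel R (step_dist G \<Delta> \<pi> \<sigma>') (step_dist G \<Theta> \<rho> \<sigma>)"
      using step[OF \<sigma>] by blast
    then show ?thesis
      using Enforce.IH[OF _ _ \<pi>] Enforce.prems(1) by fastforce
  qed
  then show ?case
    using \<rho> \<Theta> by auto
next
  case (WSum J p \<phi>)
  from WSum.prems(3) obtain D where \<Delta>: "\<Delta> = bind_pmf p D"
    and D: "\<And>j. j \<in> J \<Longrightarrow> D j \<in> sem G (\<phi> j)"
    by auto
  obtain D' where \<Theta>: "\<Theta> = bind_pmf p D'"
    and D': "\<And>j. j \<in> set_pmf p \<Longrightarrow> lift_rel R (D j) (D' j)"
      "\<And>j. j \<notin> set_pmf p \<Longrightarrow> D' j = D j"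
    using WSum.prems(2) unfolding \<Delta> by (rule lift_rel_bind_split) blast
  have "D' j \<in> sem G (\<phi> j)" if "j \<in> J" for j
  proof (cases "j \<in> set_pmf p")
    case True
    show ?thesis
      by (rule WSum.IH[OF rangeI _ D'(1)[OF True] D[OF that]]) (use WSum.prems(1) that in simp)
  next
    case False
    then show ?thesis
      using D[OF that] D'(2) by simp
  qed
  then show ?case
    using \<Theta> by auto
next
  case (USum J \<phi>)
  from USum.prems(3) obtain q D where \<Delta>: "\<Delta> = bind_pmf q D" and q: "q \<in> Dist J"
    and D: "\<And>j. j \<in> J \<Longrightarrow> D j \<in> sem G (\<phi> j)"
    by auto
  obtain D' where \<Theta>: "\<Theta> = bind_pmf q D'"
    and D': "\<And>j. j \<in> set_pmf q \<Longrightarrow> lift_rel R (D j) (D' j)"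
      "\<And>j. j \<notin> set_pmf q \<Longrightarrow> D' j = D j"
    using USum.prems(2) unfolding \<Delta> by (rule lift_rel_bind_split) blast
  have "D' j \<in> sem G (\<phi> j)" if "j \<in> J" for j
  proof (cases "j \<in> set_pmf q")
    case True
    show ?thesis
      by (rule USum.IH[OF rangeI _ D'(1)[OF True] D[OF that]]) (use USum.prems(1) that in simp)
  next
    case False
    then show ?thesis
      using D[OF that] D'(2) by simp
  qed
  \<comment> \<open>The weights \<open>q\<close> witnessing the sum for \<open>\<Delta>\<close> also
    serve \<open>\<Theta>\<close>, as splitting changes only the components.\<close>
  then show ?case
    using \<Theta> q by auto
qed

theorem theorem17:
  fixes G :: "('s, 'p, 'a, 'b) pgs"
    and \<phi> :: "('p, 'k) fmla"
    and \<Delta> \<Theta> :: "'s pmf"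
  assumes "probabilistic_game_structure G"
    and "wf_fmla (props G) \<phi>"
    and "\<Delta> \<in> Dist (states G)"
    and "\<Theta> \<in> Dist (states G)"
    and "lift_rel (pa_sim G) \<Delta> \<Theta>"
    and "satisfies G \<Delta> \<phi>"
  shows "satisfies G \<Theta> \<phi>"
  using sem_lift_rel[OF pa_simulation_pa_sim assms(2,5)] assms(6)
  by (simp add: satisfies_def)

end
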